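(* Let $A\in\mathbb{R}^{n\times n}$, $C\in\mathbb{R}^{p\times n}$, and let $N:\mathbb{R}^n\to\mathbb{R}^{n\times n}$ be linear with $x^\top N(x)x=0$ for all $x\in\mathbb{R}^n$. Let $Q\in\mathbb{R}^{n\times n}$ be such that $N(v)v=0$ whenever $v\in\ker(Q)$. Suppose that $B_r(d)$, calculated by the semidefinite program given in the context, is invariant for $\dot x=Ax+N(x)x$, and let $x(t)$ be the solution with $x(0)=x_0\in B_r(d)$. Pick $Y\subseteq\mathbb{R}^n$ such that $B_r(d)\subset Y$, and suppose that there exist a positive definite $P\in\mathcal{S}_N^n$ and $R\in\mathbb{R}^{n\times p}$ such that $$PA_y+A_y^\top P+RC+C^\top R^\top\prec0\qquad\text{for all }y\in Y.$$ Then, if $L:=P^{-1}R$, the observer $\hat x(t)$ defined by $$\dot{\hat x}=A\hat x+N(\hat x)\hat x-L(Cx-C\hat x),\qquad\hat x(0)=\hat x_0,$$ satisfies $e(t):=x(t)-\hat x(t)\to0$ as $t\to\infty$, for any initial condition $\hat x_0\in\mathbb{R}^n$.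
   Context: For $d\in\mathbb{R}^n$, $A_d$ is the matrix defined by $A_dx:=Ax+N(x)d+N(d)x$ for all $x\in\mathbb{R}^n$. $B_r(d):=\{x\in\mathbb{R}^n:\|x-d\|_2\le r\}$. $\mathcal{S}^n$ is the set of real symmetric $n\times n$ matrices and $\mathcal{S}^n_N:=\{P\in\mathcal{S}^n:e^\top PN(e)e=0\text{ for each }e\in\mathbb{R}^n\}$. For square (not necessarily symmetric) $M$: $M\succ0$ means $x^\top(M+M^\top)x>0$ for all $x\neq0$; $M\succeq0$ is the same with $\ge0$; $M\prec0$ (resp. $M\preceq0$) means $-M\succ0$ (resp. $-M\succeq0$). A set $S$ is invariant for a dynamical system if $x(t_0)\in S$ at a time $t_0\ge0$ implies $x(t)\in S$ for all $t\ge t_0$. Calculation of $B_r(d)$: consider the semidefinite program in variables $s,t\in\mathbb{R}$, $z\in\mathbb{R}^n$: minimize $s$ subject to $$\begin{bmatrix}s & (Az)^\top \\ Az & sI_n\end{bmatrix}\succeq0,\quad tA+(A_z-A)+I\preceq0,\quad t\ge0,\quad Qz=0.$$ Given an optimal solution $(s^*,t^*,z^* )$, one takes $d=z^*/t^*$, $r=s^*$ (if $s^*=0$ and $z^*=0$, one may take $d=0$ and any $r\geq 0$). *)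

theory Defs
  imports "HOL-Analysis.Analysis"
begin

text \<open>Definiteness of square matrices that need not be symmetric, via the symmetric part.\<close>

definition pos_def :: "real ^ 'n ^ 'n \<Rightarrow> bool" where
  "pos_def M \<longleftrightarrow> (\<forall>x. x \<noteq> 0 \<longrightarrow> x \<bullet> ((M + transpose M) *v x) > 0)"

definition pos_semidef :: "real ^ 'n ^ 'n \<Rightarrow> bool" where
  "pos_semidef M \<longleftrightarrow> (\<forall>x. x \<noteq> 0 \<longrightarrow> x \<bullet> ((M + transpose M) *v x) \<ge> 0)"

definition neg_def :: "real ^ 'n ^ 'n \<Rightarrow> bool" where
  "neg_def M \<longleftrightarrow> pos_def (- M)"

definition neg_semidef :: "real ^ 'n ^ 'n \<Rightarrow> bool" where
  "neg_semidef M \<longleftrightarrow> pos_semidef (- M)"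

definition sym_matrices_N :: "(real ^ 'n \<Rightarrow> real ^ 'n ^ 'n) \<Rightarrow> (real ^ 'n ^ 'n) set" where
  "sym_matrices_N N = {P. transpose P = P \<and> (\<forall>e. e \<bullet> ((P ** N e) *v e) = 0)}"

definition shifted_matrix ::
  "real ^ 'n ^ 'n \<Rightarrow> (real ^ 'n \<Rightarrow> real ^ 'n ^ 'n) \<Rightarrow> real ^ 'n \<Rightarrow> real ^ 'n ^ 'n" where
  "shifted_matrix A N d = matrix (\<lambda>x. A *v x + N x *v d + N d *v x)"

lemma shifted_matrix_works:
  assumes "linear N"
  shows "shifted_matrix A N d *v x = A *v x + N x *v d + N d *v x"
proof -
  have "linear (\<lambda>x. A *v x + N x *v d + N d *v x)"
    by (rule linearI)
      (simp_all add: linear_add[OF assms] linear_scale[OF assms] matrix_vector_right_distrib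
        matrix_vector_mult_add_rdistrib matrix_vector_mult_scaleR scaleR_matrix_vector_assoc
        algebra_simps)
  then show ?thesis
    unfolding shifted_matrix_def
    by (intro matrix_works) (simp add: linear_matrix_vector_mul_eq)
qed

text \<open>The matrix with blocks \<open>s\<close> and \<open>v\<close> transposed in the first row, \<open>v\<close> and \<open>s\<close> times the
  identity below; the summand \<open>unit\<close> of the index type is the first row and column.\<close>

definition bordered_matrix :: "real \<Rightarrow> real ^ 'n \<Rightarrow> real ^ (unit + 'n) ^ (unit + 'n)" where
  "bordered_matrix s v = (\<chi> i j. case i of
       Inl _ \<Rightarrow> (case j of Inl _ \<Rightarrow> s | Inr l \<Rightarrow> v $ l)
     | Inr k \<Rightarrow> (case j of Inl _ \<Rightarrow> v $ k | Inr l \<Rightarrow> (s *\<^sub>R mat 1 :: real ^ 'n ^ 'n) $ k $ l))"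

definition sdp_feasible ::
  "real ^ 'n ^ 'n \<Rightarrow> (real ^ 'n \<Rightarrow> real ^ 'n ^ 'n) \<Rightarrow> real ^ 'n ^ 'n \<Rightarrow>
     real \<Rightarrow> real \<Rightarrow> real ^ 'n \<Rightarrow> bool" where
  "sdp_feasible A N Q s t z \<longleftrightarrow>
     pos_semidef (bordered_matrix s (A *v z)) \<and>
     neg_semidef (t *\<^sub>R A + (shifted_matrix A N z - A) + mat 1) \<and>
     t \<ge> 0 \<and> Q *v z = 0"

definition sdp_optimal ::
  "real ^ 'n ^ 'n \<Rightarrow> (real ^ 'n \<Rightarrow> real ^ 'n ^ 'n) \<Rightarrow> real ^ 'n ^ 'n \<Rightarrow>
     real \<Rightarrow> real \<Rightarrow> real ^ 'n \<Rightarrow> bool" where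
  "sdp_optimal A N Q s t z \<longleftrightarrow>
     sdp_feasible A N Q s t z \<and> (\<forall>s' t' z'. sdp_feasible A N Q s' t' z' \<longrightarrow> s \<le> s')"

text \<open>The ball \<open>cball d r\<close> is obtained from an optimal solution. The quotient is not
  degenerate: if \<open>N v *v v = 0\<close> on the kernel of \<open>Q\<close>, no feasible point has \<open>t = 0\<close>,
  as then testing the second constraint with \<open>z\<close> gives \<open>z = 0\<close>, leaving the identity matrix
  negative semidefinite.\<close>

definition sdp_ball ::
  "real ^ 'n ^ 'n \<Rightarrow> (real ^ 'n \<Rightarrow> real ^ 'n ^ 'n) \<Rightarrow> real ^ 'n ^ 'n \<Rightarrow>
     real ^ 'n \<Rightarrow> real \<Rightarrow> bool" where
  "sdp_ball A N Q d r \<longleftrightarrow>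
     (\<exists>s t z. sdp_optimal A N Q s t z \<and>
        (d = z /\<^sub>R t \<and> r = s \<or> s = 0 \<and> z = 0 \<and> d = 0 \<and> r \<ge> 0))"

definition ode_solution :: "(real \<Rightarrow> real ^ 'n \<Rightarrow> real ^ 'n) \<Rightarrow> (real \<Rightarrow> real ^ 'n) \<Rightarrow> bool" where
  "ode_solution f x \<longleftrightarrow>
     (\<forall>t\<ge>0. (x has_vector_derivative f t (x t)) (at t within {0..}))"

definition system_rhs ::
  "real ^ 'n ^ 'n \<Rightarrow> (real ^ 'n \<Rightarrow> real ^ 'n ^ 'n) \<Rightarrow> real ^ 'n \<Rightarrow> real ^ 'n" where
  "system_rhs A N v = A *v v + N v *v v"

definition observer_rhs ::
  "real ^ 'n ^ 'n \<Rightarrow> (real ^ 'n \<Rightarrow> real ^ 'n ^ 'n) \<Rightarrow> real ^ 'n ^ 'p \<Rightarrow> real ^ 'p ^ 'n \<Rightarrow>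
     (real \<Rightarrow> real ^ 'n) \<Rightarrow> real \<Rightarrow> real ^ 'n \<Rightarrow> real ^ 'n" where
  "observer_rhs A N C L x t v = A *v v + N v *v v - L *v (C *v x t - C *v v)"

text \<open>Only solutions on all of \<open>[0, \<infinity>)\<close> are considered. For \<open>system_rhs A N\<close> with
  \<open>v \<bullet> (N v *v v) = 0\<close> this loses nothing: the squared norm of a solution grows at most
  exponentially, so there is no blow-up in forward time.\<close>

definition invariant_set :: "(real ^ 'n \<Rightarrow> real ^ 'n) \<Rightarrow> (real ^ 'n) set \<Rightarrow> bool" where
  "invariant_set f S \<longleftrightarrow>
     (\<forall>x. ode_solution (\<lambda>_. f) x \<longrightarrow>
        (\<forall>t\<^sub>0\<ge>0. x t\<^sub>0 \<in> S \<longrightarrow> (\<forall>t\<ge>t\<^sub>0. x t \<in> S)))"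

end

theory Submission imports Defs begin

text \<open>The error \<open>e = x - xhat\<close> solves an equation in which the observer state no longer occurs:
  \<open>e' = A\<^sub>x e + L C e - N(e) e\<close>, where \<open>A\<^sub>x\<close> is the shifted matrix at the current state \<open>x t\<close>
  (lemma \<open>system_minus_observer_rhs\<close>). Along it the energy \<open>e \<bullet> P e\<close> has the derivative
  \<open>e \<bullet> M\<^sub>x e\<close>, where \<open>M\<^sub>x = P A\<^sub>x + A\<^sub>x\<^sup>T P + R C + C\<^sup>T R\<^sup>T\<close>, because \<open>P L = R\<close> and because
  membership of \<open>P\<close> in \<open>sym_matrices_N N\<close> makes the contribution of the quadratic term
  vanish. By invariance \<open>x t\<close> stays in the ball, and the ball is compact, so that the pointwise
  negative definiteness of \<open>M\<^sub>y\<close> becomes uniform and the energy decays exponentially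
  (lemma \<open>error_exponential_decay\<close>).

  That the observer has a solution on all of \<open>[0, \<infinity>)\<close> is a separate claim, as its right-hand side
  is quadratic. The same energy estimate settles it: replace the quadratic term \<open>N(e) e\<close> of the
  error equation by its value at the projection of \<open>e\<close> to a large ball. This field is globally
  Lipschitz, so a fixed point argument in a weighted norm gives a global solution
  (lemmas \<open>lipschitz_ode_global_solution\<close> and \<open>truncated_error_solution\<close>). The projection is a
  rescaling, so the truncated quadratic term is a scalar multiple of the original one and is still
  invisible to the energy. Hence the truncated solution never leaves a sublevel set of the energy,
  and if the ball contains that set, it solves the original equation.\<close>

section \<open>Global solutions of Lipschitz equations\<close>

lemma weighted_integral_bound:
  fixes g :: "real \<Rightarrow> 'a::banach"
  assumes "continuous_on {0..} g" and "0 < a" and "0 \<le> t"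
    and bound: "\<And>s. 0 \<le> s \<Longrightarrow> norm (g s) \<le> M * exp (a * s)"
  shows "norm (exp (- a * t) *\<^sub>R integral {0..t} g) \<le> M / a"
proof -
  have "0 \<le> M"
    using order_trans[OF norm_ge_zero bound[of 0]] by simp
  have "((\<lambda>s. M * exp (a * s)) has_integral M * exp (a * t) / a - M * exp (a * 0) / a) {0..t}"
    by (rule fundamental_theorem_of_calculus)
      (use assms in \<open>auto intro!: derivative_eq_intros
        simp flip: has_real_derivative_iff_has_vector_derivative\<close>)
  moreover have "g integrable_on {0..t}"
    by (rule integrable_continuous_real, rule continuous_on_subset[OF assms(1)]) auto
  ultimately have "norm (integral {0..t} g) \<le> M * exp (a * t) / a - M / a"
    using Henstock_Kurzweil_Integration.integral_norm_bound_integral[of g "{0..t}" "\<lambda>s. M * exp (a * s)"] bound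
    by (auto simp: has_integral_iff)
  also have "\<dots> \<le> M * exp (a * t) / a"
    using \<open>0 \<le> M\<close> \<open>0 < a\<close> by simp
  finally have "exp (- a * t) * norm (integral {0..t} g) \<le> exp (- a * t) * (M * exp (a * t) / a)"
    by (intro mult_left_mono) auto
  then show ?thesis
    by (simp add: exp_minus field_simps)
qed

lemma integral_has_vector_derivative_half_line:
  fixes g :: "real \<Rightarrow> 'a::banach"
  assumes "continuous_on {0..} g" and "0 \<le> t"
  shows "((\<lambda>t. integral {0..t} g) has_vector_derivative g t) (at t within {0..})"
proof -
  have "continuous_on {0..t + 1} g"
    by (rule continuous_on_subset[OF assms(1)]) auto
  then have "((\<lambda>t. integral {0..t} g) has_vector_derivative g t) (at t within {0..t + 1})"
    by (rule integral_has_vector_derivative) (use assms in auto)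
  moreover have "at t within {0..t + 1} = at t within {0..}"
    by (rule at_within_nhd[of _ "{..<t + 1}"]) auto
  ultimately show ?thesis
    by simp
qed

text \<open>The integral equation is solved on the whole half-line at once. With \<open>u t = exp (a t) w t\<close>
  the unknown becomes a bounded continuous function \<open>w\<close>, and the Picard operator has the Lipschitz
  constant \<open>k / a\<close> in the supremum norm, so \<open>a = 2 k\<close> makes it a contraction.\<close>

lemma lipschitz_ode_global_solution:
  fixes f :: "real \<Rightarrow> 'a::banach \<Rightarrow> 'a"
  assumes cont: "continuous_on ({0..} \<times> UNIV) (\<lambda>(t, v). f t v)"
    and lip: "\<And>t v w. 0 \<le> t \<Longrightarrow> norm (f t v - f t w) \<le> K * norm (v - w)"
    and bounded: "\<And>t. 0 \<le> t \<Longrightarrow> norm (f t 0) \<le> B"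
  shows "\<exists>u. u 0 = u\<^sub>0 \<and> (\<forall>t\<ge>0. (u has_vector_derivative f t (u t)) (at t within {0..}))"
proof -
  \<comment> \<open>The given constant may vanish or be negative, and the exponent \<open>a\<close> has to be positive.\<close>
  define k where "k = max K 1"
  define a where "a = 2 * k"
  have "0 < k" "0 < a" "0 \<le> B"
    using bounded[of 0] norm_ge_zero[of "f 0 0"] by (auto simp: k_def a_def simp del: norm_ge_zero)
  have lip': "norm (f t v - f t w) \<le> k * norm (v - w)" if "0 \<le> t" for t v w
    by (rule order_trans[OF lip[OF that]]) (auto simp: k_def intro: mult_right_mono)
  define g where "g w s = f s (exp (a * s) *\<^sub>R apply_bcontfun w s)" for w s
  \<comment> \<open>Bounded continuous functions live on the whole line; negative times are clamped to \<open>0\<close>.\<close>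
  define F where
    "F w t = exp (- a * max 0 t) *\<^sub>R (u\<^sub>0 + integral {0..max 0 t} (g w))" for w t
  have cont_g: "continuous_on {0..} (g w)" for w
  proof -
    have "continuous_on {0..} (\<lambda>s. (s, exp (a * s) *\<^sub>R apply_bcontfun w s))"
      by (intro continuous_intros) auto
    then show ?thesis
      unfolding g_def using continuous_on_compose2[OF cont] by fastforce
  qed
  have cont_F: "continuous_on UNIV (F w)" for w
  proof -
    have "continuous_on {0..} (\<lambda>t. integral {0..t} (g w))"
      by (rule continuous_on_vector_derivative,
          rule integral_has_vector_derivative_half_line, rule cont_g) auto
    then have "continuous_on UNIV (\<lambda>t. integral {0..max 0 t} (g w))"
      by (rule continuous_on_compose2) (auto intro!: continuous_intros)
    then show ?thesis
      unfolding F_def by (intro continuous_intros)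
  qed
  have F_bcontfun: "F w \<in> bcontfun" for w
  proof (rule bcontfun_normI[OF cont_F])
    fix t :: real
    define \<tau> where "\<tau> = max 0 t"
    have "norm (exp (- a * \<tau>) *\<^sub>R integral {0..\<tau>} (g w)) \<le> (B + k * norm w) / a"
    proof (rule weighted_integral_bound[OF cont_g \<open>0 < a\<close>])
      fix s :: real assume s: "0 \<le> s"
      have "1 \<le> exp (a * s)"
        using s \<open>0 < a\<close> by simp
      have "norm (g w s) \<le> norm (f s 0) + norm (g w s - f s 0)"
        by (rule norm_triangle_sub)
      also have "\<dots> \<le> B + k * (exp (a * s) * norm (apply_bcontfun w s))"
        using bounded[OF s] lip'[OF s, of "exp (a * s) *\<^sub>R apply_bcontfun w s" 0]
        by (simp add: g_def)
      also have "\<dots> \<le> B * exp (a * s) + k * (exp (a * s) * norm w)"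
        using \<open>1 \<le> exp (a * s)\<close> \<open>0 < k\<close> \<open>0 \<le> B\<close> mult_left_mono[of 1 "exp (a * s)" B]
        by (intro add_mono mult_left_mono norm_bounded) auto
      finally show "norm (g w s) \<le> (B + k * norm w) * exp (a * s)"
        by (simp add: algebra_simps)
    qed (simp add: \<tau>_def)
    moreover have "norm (exp (- a * \<tau>) *\<^sub>R u\<^sub>0) \<le> norm u\<^sub>0"
      using \<open>0 < a\<close> by (auto simp: \<tau>_def intro!: mult_left_le_one_le)
    ultimately show "norm (F w t) \<le> norm u\<^sub>0 + (B + k * norm w) / a"
      unfolding F_def \<tau>_def[symmetric] scaleR_add_right by (rule norm_triangle_mono[rotated])
  qed
  have contraction: "dist (Bcontfun (F v)) (Bcontfun (F w)) \<le> 1 / 2 * dist v w" for v w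
  proof (rule dist_bound)
    fix t :: real
    define \<tau> where "\<tau> = max 0 t"
    have "0 \<le> \<tau>"
      by (simp add: \<tau>_def)
    have int: "g w integrable_on {0..\<tau>}" for w
      by (rule integrable_continuous_real, rule continuous_on_subset[OF cont_g]) auto
    have "norm (exp (- a * \<tau>) *\<^sub>R integral {0..\<tau>} (\<lambda>s. g v s - g w s)) \<le> k * dist v w / a"
    proof (rule weighted_integral_bound[OF _ \<open>0 < a\<close> \<open>0 \<le> \<tau>\<close>])
      show "continuous_on {0..} (\<lambda>s. g v s - g w s)"
        by (intro continuous_intros cont_g)
      fix s :: real assume s: "0 \<le> s"
      have "norm (g v s - g w s) \<le> k * (exp (a * s) * dist (apply_bcontfun v s) (apply_bcontfun w s))"
        unfolding g_def by (rule order_trans[OF lip'[OF s]])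
          (simp add: dist_norm flip: scaleR_diff_right)
      also have "\<dots> \<le> k * (exp (a * s) * dist v w)"
        using \<open>0 < k\<close> by (intro mult_left_mono dist_bounded) auto
      finally show "norm (g v s - g w s) \<le> k * dist v w * exp (a * s)"
        by (simp add: algebra_simps)
    qed
    moreover have "F v t - F w t = exp (- a * \<tau>) *\<^sub>R integral {0..\<tau>} (\<lambda>s. g v s - g w s)"
      by (simp add: F_def flip: \<tau>_def) (simp add: integral_diff[OF int int] algebra_simps)
    ultimately show
      "dist (apply_bcontfun (Bcontfun (F v)) t) (apply_bcontfun (Bcontfun (F w)) t)
         \<le> 1 / 2 * dist v w"
      using \<open>0 < k\<close> by (simp add: Bcontfun_inverse[OF F_bcontfun] dist_norm a_def)
  qed
  obtain w where w: "Bcontfun (F w) = w"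
    using banach_fix_type[of "1 / 2" "\<lambda>w. Bcontfun (F w)"] contraction by auto
  define u where "u t = exp (a * t) *\<^sub>R apply_bcontfun w t" for t
  have u: "u t = u\<^sub>0 + integral {0..t} (g w)" if "0 \<le> t" for t
  proof -
    have "apply_bcontfun w t = F w t"
      by (metis w Bcontfun_inverse[OF F_bcontfun])
    then show ?thesis
      using that by (simp add: u_def F_def flip: exp_add)
  qed
  have "(u has_vector_derivative f t (u t)) (at t within {0..})" if "0 \<le> t" for t
  proof -
    have "((\<lambda>t. u\<^sub>0 + integral {0..t} (g w)) has_vector_derivative g w t) (at t within {0..})"
      using integral_has_vector_derivative_half_line[OF cont_g that]
      by (auto intro!: derivative_eq_intros)
    then have "(u has_vector_derivative g w t) (at t within {0..})"
      by (rule has_vector_derivative_transform[rotated 2]) (use that u in auto)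
    then show ?thesis
      by (simp add: g_def u_def)
  qed
  moreover have "u 0 = u\<^sub>0"
    by (simp add: u)
  ultimately show ?thesis
    by blast
qed

section \<open>Energy decay\<close>

lemma exponential_decay:
  fixes v :: "real \<Rightarrow> real"
  assumes deriv: "\<And>t. 0 \<le> t \<Longrightarrow> (v has_real_derivative v' t) (at t within {0..})"
    and le: "\<And>t. 0 \<le> t \<Longrightarrow> v' t \<le> - c * v t"
    and "0 \<le> t"
  shows "v t \<le> v 0 * exp (- c * t)"
proof -
  let ?w = "\<lambda>t. v t * exp (c * t)"
  have w: "(?w has_real_derivative (v' s + c * v s) * exp (c * s)) (at s within {0..})"
    if "0 \<le> s" for s
    using deriv[OF that] by (auto intro!: derivative_eq_intros simp: algebra_simps)
  have "?w t \<le> ?w 0"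
  proof (rule DERIV_nonpos_imp_decreasing_open[OF \<open>0 \<le> t\<close>])
    fix s :: real assume "0 < s" "s < t"
    then have "at s within {0..} = at s"
      by (intro at_within_interior) simp
    then show "\<exists>y. (?w has_real_derivative y) (at s) \<and> y \<le> 0"
      using w[of s] le[of s] \<open>0 < s\<close> by (intro exI conjI) (auto simp: mult_le_0_iff)
  next
    show "continuous_on {0..t} ?w"
      by (rule continuous_on_subset[of "{0..}"], rule DERIV_continuous_on, rule w) auto
  qed
  then have "v t * exp (c * t) * exp (- c * t) \<le> v 0 * exp (- c * t)"
    by (intro mult_right_mono) auto
  then show ?thesis
    by (simp add: mult.assoc flip: exp_add)
qed

text \<open>By homogeneity it suffices to minimise over the unit sphere, where compactness makes the
  minimum positive.\<close>

lemma uniform_quadratic_lower_bound: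
  fixes h :: "'a::topological_space \<Rightarrow> 'b::euclidean_space \<Rightarrow> real"
  assumes "compact S" and "S \<noteq> {}"
    and cont: "continuous_on (S \<times> UNIV) (\<lambda>(y, v). h y v)"
    and homogeneous: "\<And>y c v. y \<in> S \<Longrightarrow> h y (c *\<^sub>R v) = c\<^sup>2 * h y v"
    and pos: "\<And>y v. y \<in> S \<Longrightarrow> v \<noteq> 0 \<Longrightarrow> 0 < h y v"
  obtains k where "0 < k" and "\<And>y v. y \<in> S \<Longrightarrow> k * (norm v)\<^sup>2 \<le> h y v"
proof -
  let ?D = "S \<times> (sphere 0 1 :: 'b set)"
  have "compact ?D"
    using assms by (intro compact_Times) auto
  moreover have "?D \<noteq> {}"
    using \<open>S \<noteq> {}\<close> by (simp add: Times_empty)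
  moreover have "continuous_on ?D (\<lambda>(y, v). h y v)"
    by (rule continuous_on_subset[OF cont]) auto
  ultimately obtain p where p: "p \<in> ?D" "\<And>q. q \<in> ?D \<Longrightarrow> case_prod h p \<le> case_prod h q"
    using continuous_attains_inf[of ?D "case_prod h"] by blast
  show thesis
  proof
    show "0 < case_prod h p"
      using p(1) by (cases p) (auto intro!: pos)
    fix y and v :: 'b assume y: "y \<in> S"
    show "case_prod h p * (norm v)\<^sup>2 \<le> h y v"
    proof (cases "v = 0")
      case True
      then show ?thesis
        using homogeneous[OF y, of 0 0] by simp
    next
      case False
      then have "case_prod h p * (norm v)\<^sup>2 \<le> h y (v /\<^sub>R norm v) * (norm v)\<^sup>2"
        using p(2)[of "(y, v /\<^sub>R norm v)"] y by (intro mult_right_mono) auto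
      also have "\<dots> = h y v"
        using homogeneous[OF y, of "norm v" "v /\<^sub>R norm v"] False by (simp add: mult.commute)
      finally show ?thesis .
    qed
  qed
qed

section \<open>Truncating the quadratic term\<close>

text \<open>That the projection onto a centred ball is radial is what lets the truncated quadratic term
  stay proportional to the original one.\<close>

lemma closest_point_cball_0:
  fixes v :: "'a::euclidean_space"
  assumes "0 \<le> \<rho>"
  obtains c where "closest_point (cball 0 \<rho>) v = c *\<^sub>R v"
proof (cases "norm v \<le> \<rho>")
  case True
  then show thesis
    using that[of 1] by (simp add: closest_point_self)
next
  case False
  then have "0 < norm v"
    using assms by linarith
  have "(\<rho> / norm v) *\<^sub>R v = closest_point (cball 0 \<rho>) v"
  proof (rule closest_point_unique)
    show "(\<rho> / norm v) *\<^sub>R v \<in> cball 0 \<rho>"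
      using assms \<open>0 < norm v\<close> by simp
    show "\<forall>z\<in>cball 0 \<rho>. dist v ((\<rho> / norm v) *\<^sub>R v) \<le> dist v z"
    proof
      fix z :: 'a assume "z \<in> cball 0 \<rho>"
      have "dist v ((\<rho> / norm v) *\<^sub>R v) = norm ((1 - \<rho> / norm v) *\<^sub>R v)"
        by (simp add: dist_norm algebra_simps)
      also have "\<dots> = norm v - \<rho>"
        using False \<open>0 < norm v\<close> by (simp add: field_simps)
      also have "\<dots> \<le> norm v - norm z"
        using \<open>z \<in> cball 0 \<rho>\<close> by simp
      also have "\<dots> \<le> dist v z"
        by (simp add: dist_norm norm_triangle_ineq2)
      finally show "dist v ((\<rho> / norm v) *\<^sub>R v) \<le> dist v z" .
    qed
  qed auto
  then show thesis
    using that by metis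
qed

lemma bilinear_square_truncation_lipschitz:
  fixes b :: "'a::euclidean_space \<Rightarrow> 'a \<Rightarrow> 'b::real_normed_vector"
  assumes "bounded_bilinear b" and "0 \<le> \<rho>"
  defines "\<pi> \<equiv> closest_point (cball 0 \<rho>)"
  obtains k where "\<And>v w. norm (b (\<pi> v) (\<pi> v) - b (\<pi> w) (\<pi> w)) \<le> k * norm (v - w)"
proof -
  interpret bounded_bilinear b by fact
  obtain m where m: "0 \<le> m" "\<And>v w. norm (b v w) \<le> norm v * norm w * m"
    using nonneg_bounded by blast
  have \<pi>: "norm (\<pi> v) \<le> \<rho>" for v
    using closest_point_in_set[of "cball 0 \<rho>" v] \<open>0 \<le> \<rho>\<close> by (auto simp: \<pi>_def)
  have \<pi>_lip: "norm (\<pi> v - \<pi> w) \<le> norm (v - w)" for v w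
    unfolding \<pi>_def using closest_point_lipschitz[of "cball 0 \<rho>" v w] \<open>0 \<le> \<rho>\<close>
    by (auto simp: dist_norm)
  have "norm (b (\<pi> v) (\<pi> v) - b (\<pi> w) (\<pi> w)) \<le> 2 * \<rho> * m * norm (v - w)" for v w
  proof -
    have "b (\<pi> v) (\<pi> v) - b (\<pi> w) (\<pi> w) = b (\<pi> v) (\<pi> v - \<pi> w) + b (\<pi> v - \<pi> w) (\<pi> w)"
      by (simp add: diff_left diff_right)
    also have "norm \<dots> \<le> \<rho> * norm (v - w) * m + norm (v - w) * \<rho> * m"
      using \<pi> \<pi>_lip m(1) \<open>0 \<le> \<rho>\<close>
      by (intro order_trans[OF norm_triangle_ineq] add_mono order_trans[OF m(2)] mult_right_mono
          mult_mono) auto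
    finally show ?thesis
      by (simp add: algebra_simps)
  qed
  then show thesis
    using that by blast
qed

section \<open>Definite matrices and the Lyapunov form\<close>

lemma inner_transpose_matrix: "v \<bullet> (transpose M *v w) = (M *v v) \<bullet> w"
  for M :: "real ^ 'n ^ 'm"
  by (metis dot_lmul_matrix inner_commute transpose_matrix_vector)

lemma pos_def_iff: "pos_def M \<longleftrightarrow> (\<forall>v. v \<noteq> 0 \<longrightarrow> 0 < v \<bullet> (M *v v))"
proof -
  have "v \<bullet> (transpose M *v v) = v \<bullet> (M *v v)" for v
    unfolding inner_transpose_matrix by (rule inner_commute)
  then show ?thesis
    by (simp add: pos_def_def matrix_vector_mult_add_rdistrib inner_add_right)
qed

lemma neg_def_iff: "neg_def M \<longleftrightarrow> (\<forall>v. v \<noteq> 0 \<longrightarrow> v \<bullet> (M *v v) < 0)"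
proof -
  have "(- M) *v v = - (M *v v)" for v
    using matrix_vector_mult_diff_rdistrib[of 0 M v] by simp
  then show ?thesis
    by (simp add: neg_def_def pos_def_iff)
qed

lemma pos_def_imp_invertible:
  assumes "pos_def P"
  shows "invertible P"
proof -
  have "v = 0" if "P *v v = 0" for v
    using assms that by (auto simp: pos_def_iff)
  then show ?thesis
    by (simp add: invertible_left_inverse matrix_left_invertible_ker)
qed

lemma lyapunov_quadratic_form:
  fixes P S :: "real ^ 'n ^ 'n" and L :: "real ^ 'p ^ 'n" and C :: "real ^ 'n ^ 'p"
  assumes "transpose P = P" and "P ** L = R"
  shows "v \<bullet> ((P ** S + transpose S ** P + R ** C + transpose C ** transpose R) *v v)
    = 2 * (v \<bullet> (P *v (S *v v + (L ** C) *v v)))"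
proof -
  have "v \<bullet> (transpose S *v (P *v v)) = v \<bullet> (P *v (S *v v))"
    using inner_transpose_matrix[of v S "P *v v"] inner_transpose_matrix[of "S *v v" P v] assms(1)
    by (simp add: inner_commute del: transpose_matrix_vector)
  moreover have "v \<bullet> (transpose C *v (transpose R *v v)) = v \<bullet> (R *v (C *v v))"
    unfolding inner_transpose_matrix by (rule inner_commute)
  moreover have "P *v (L *v w) = R *v w" for w
    by (simp add: matrix_vector_mul_assoc assms(2))
  ultimately show ?thesis
    by (simp add: matrix_vector_mult_add_rdistrib matrix_vector_right_distrib inner_add_right
        flip: matrix_vector_mul_assoc)
qed

lemma bounded_bilinear_matrix_valued:
  fixes N :: "real ^ 'n \<Rightarrow> real ^ 'n ^ 'n"
  assumes "linear N"
  shows "bounded_bilinear (\<lambda>v w. N v *v w)"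
  unfolding bilinear_conv_bounded_bilinear[symmetric] bilinear_def
  by (auto intro!: linearI simp: linear_add[OF assms] linear_scale[OF assms]
      matrix_vector_right_distrib matrix_vector_mult_add_rdistrib matrix_vector_mult_scaleR
      scaleR_matrix_vector_assoc)

section \<open>The error equation\<close>

text \<open>The error of the observer has \<open>\<gamma> = 1\<close> and \<open>G = L ** C\<close>; for the truncated error equation,
  \<open>\<gamma>\<close> is the square of the factor by which the projection rescales the argument.\<close>

definition error_rhs ::
  "real ^ 'n ^ 'n \<Rightarrow> (real ^ 'n \<Rightarrow> real ^ 'n ^ 'n) \<Rightarrow> real ^ 'n ^ 'n \<Rightarrow> real \<Rightarrow>
     real ^ 'n \<Rightarrow> real ^ 'n \<Rightarrow> real ^ 'n" where
  "error_rhs A N G \<gamma> y v = shifted_matrix A N y *v v + G *v v - \<gamma> *\<^sub>R (N v *v v)"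

text \<open>Linearity of \<open>N\<close> gives, for \<open>e = x - v\<close>, the polarisation identity
  \<open>N(x) x - N(v) v = N(x) e + N(e) x - N(e) e\<close>; the first two terms belong to the shifted matrix.\<close>

lemma system_minus_observer_rhs:
  fixes A :: "real ^ 'n ^ 'n"
  assumes "linear N"
  shows "system_rhs A N (x t) - observer_rhs A N C L x t v
    = error_rhs A N (L ** C) 1 (x t) (x t - v)"
  by (simp add: system_rhs_def observer_rhs_def error_rhs_def shifted_matrix_works[OF assms]
      linear_diff[OF assms] matrix_vector_mult_diff_distrib matrix_vector_mult_diff_rdistrib
      flip: matrix_vector_mul_assoc)

text \<open>The factor \<open>\<gamma>\<close> may vary arbitrarily along the solution, since \<open>v \<bullet> P N(v) v = 0\<close> removes the
  quadratic term from the energy balance. The constants do not depend on \<open>\<gamma>\<close> or on the solution,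
  so one radius serves for the truncation before the truncated solution is known.\<close>

lemma error_exponential_decay:
  fixes A P :: "real ^ 'n ^ 'n" and C :: "real ^ 'n ^ 'p" and L :: "real ^ 'p ^ 'n"
  assumes "linear N" and P: "P \<in> sym_matrices_N N" "pos_def P" and "P ** L = R"
    and "compact K" and trajectory: "x ` {0..} \<subseteq> K"
    and neg: "\<And>y. y \<in> K \<Longrightarrow>
           neg_def (P ** shifted_matrix A N y + transpose (shifted_matrix A N y) ** P
                    + R ** C + transpose C ** transpose R)"
  shows "\<exists>q>0. \<exists>\<kappa>>0. \<forall>e \<gamma>.
    ode_solution (\<lambda>t. error_rhs A N (L ** C) (\<gamma> t) (x t)) e
    \<longrightarrow> (\<forall>t\<ge>0. q * (norm (e t))\<^sup>2 \<le> (e 0 \<bullet> (P *v e 0)) * exp (- \<kappa> * t))"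
proof -
  have sym: "transpose P = P" and PN: "v \<bullet> (P *v (N v *v v)) = 0" for v
    using P by (auto simp: sym_matrices_N_def matrix_vector_mul_assoc)
  interpret N: bounded_bilinear "\<lambda>v w. N v *v w"
    by (rule bounded_bilinear_matrix_valued) fact
  note cont = continuous_intros N.continuous_on
    bounded_linear.continuous_on[OF matrix_vector_mul_bounded_linear]
  \<comment> \<open>No parameter here: a singleton takes the place of the compact set.\<close>
  obtain q where q: "0 < q" "q * (norm v)\<^sup>2 \<le> v \<bullet> (P *v v)" for v
  proof (rule uniform_quadratic_lower_bound[of "{0}" "\<lambda>_ v. v \<bullet> (P *v v)"])
    show "continuous_on ({0} \<times> UNIV) (\<lambda>(y, v). v \<bullet> (P *v v))"
      unfolding case_prod_beta by (intro cont)
  qed (use P in \<open>auto simp: pos_def_iff matrix_vector_mult_scaleR power2_eq_square\<close>)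
  \<comment> \<open>The negative of the derivative of the energy, for a state at \<open>y\<close> and an error \<open>v\<close>.\<close>
  define h where "h y v = - (2 * (v \<bullet> (P *v (shifted_matrix A N y *v v + (L ** C) *v v))))" for y v
  obtain k where k: "0 < k" "y \<in> K \<Longrightarrow> k * (norm v)\<^sup>2 \<le> h y v" for y v
  proof (rule uniform_quadratic_lower_bound[OF \<open>compact K\<close>, of h])
    show "K \<noteq> {}"
      using trajectory by auto
    show "continuous_on (K \<times> UNIV) (\<lambda>(y, v). h y v)"
      unfolding case_prod_beta h_def shifted_matrix_works[OF \<open>linear N\<close>] by (intro cont)
    show "0 < h y v" if "y \<in> K" "v \<noteq> 0" for y v
      using neg[OF that(1)] that(2)
      by (simp add: neg_def_iff lyapunov_quadratic_form[OF sym \<open>P ** L = R\<close>] h_def)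
  qed (auto simp: h_def matrix_vector_mult_scaleR power2_eq_square simp flip: scaleR_add_right)
  obtain p where p: "0 < p" "norm (P *v v) \<le> norm v * p" for v
    using bounded_linear.pos_bounded[OF matrix_vector_mul_bounded_linear[of P]] by blast
  have decay: "q * (norm (e t))\<^sup>2 \<le> (e 0 \<bullet> (P *v e 0)) * exp (- (k / p) * t)"
    if "ode_solution (\<lambda>t. error_rhs A N (L ** C) (\<gamma> t) (x t)) e"
      and "0 \<le> t"
    for e \<gamma> t
  proof -
    have x: "x t \<in> K" if "0 \<le> t" for t
      using trajectory that by auto
    have e: "(e has_vector_derivative error_rhs A N (L ** C) (\<gamma> t) (x t) (e t)) (at t within {0..})"
      if "0 \<le> t" for t
      using \<open>ode_solution _ e\<close> that by (simp add: ode_solution_def)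
    have "((\<lambda>t. e t \<bullet> (P *v e t)) has_real_derivative - h (x t) (e t)) (at t within {0..})"
      if "0 \<le> t" for t
    proof -
      let ?e' = "error_rhs A N (L ** C) (\<gamma> t) (x t) (e t)"
      have "((\<lambda>t. e t \<bullet> (P *v e t)) has_vector_derivative e t \<bullet> (P *v ?e') + ?e' \<bullet> (P *v e t))
          (at t within {0..})"
        using bounded_bilinear.has_vector_derivative[OF bounded_bilinear_inner e[OF that]
            bounded_linear.has_vector_derivative[OF matrix_vector_mul_bounded_linear e[OF that]]] .
      moreover have "?e' \<bullet> (P *v e t) = e t \<bullet> (P *v ?e')"
        using inner_transpose_matrix[of ?e' P "e t"] sym by (simp add: inner_commute)
      moreover have "2 * (e t \<bullet> (P *v ?e')) = - h (x t) (e t)"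
        by (simp add: h_def error_rhs_def matrix_vector_mult_diff_distrib
            matrix_vector_mult_scaleR inner_diff_right PN)
      ultimately show ?thesis
        by (simp add: has_real_derivative_iff_has_vector_derivative)
    qed
    moreover have "- h (x t) (e t) \<le> - (k / p) * (e t \<bullet> (P *v e t))" if "0 \<le> t" for t
    proof -
      have "e t \<bullet> (P *v e t) \<le> norm (e t) * (norm (e t) * p)"
        by (intro order_trans[OF norm_cauchy_schwarz] mult_left_mono p) auto
      then have "k / p * (e t \<bullet> (P *v e t)) \<le> k / p * (norm (e t) * (norm (e t) * p))"
        using k(1) p(1) by (intro mult_left_mono) auto
      also have "\<dots> \<le> h (x t) (e t)"
        using k(2)[OF x[OF that], of "e t"] p(1) by (simp add: power2_eq_square field_simps)
      finally show ?thesis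
        by simp
    qed
    ultimately have "e t \<bullet> (P *v e t) \<le> (e 0 \<bullet> (P *v e 0)) * exp (- (k / p) * t)"
      using \<open>0 \<le> t\<close> by (rule exponential_decay)
    then show ?thesis
      using q(2)[of "e t"] by linarith
  qed
  show ?thesis
    by (intro exI[of _ q] exI[of _ "k / p"] conjI allI impI q(1) divide_pos_pos[OF k(1) p(1)] decay)
qed

text \<open>The linear part is Lipschitz uniformly in time because \<open>x\<close> is bounded; the quadratic part
  because it is evaluated only in a ball.\<close>

lemma truncated_error_solution:
  fixes A G :: "real ^ 'n ^ 'n"
  assumes "linear N" and "0 \<le> \<rho>"
    and x: "continuous_on {0..} x" "bounded (x ` {0..})"
  defines "\<pi> \<equiv> closest_point (cball 0 \<rho>)"
  obtains e where "e 0 = e\<^sub>0" and "ode_solution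
      (\<lambda>t v. shifted_matrix A N (x t) *v v + G *v v - N (\<pi> v) *v \<pi> v) e"
proof -
  interpret N: bounded_bilinear "\<lambda>v w. N v *v w"
    by (rule bounded_bilinear_matrix_valued) fact
  define lin where "lin t v = shifted_matrix A N (x t) *v v + G *v v" for t v
  define f where "f t v = lin t v - N (\<pi> v) *v \<pi> v" for t v
  obtain X where X: "norm (x t) \<le> X" if "0 \<le> t" for t
    using x(2) by (auto simp: bounded_iff)
  obtain a where a: "norm (A *v v) \<le> norm v * a" for v
    using bounded_linear.bounded[OF matrix_vector_mul_bounded_linear[of A]] by blast
  obtain g where g: "norm (G *v v) \<le> norm v * g" for v
    using bounded_linear.bounded[OF matrix_vector_mul_bounded_linear[of G]] by blast
  obtain m where m: "0 \<le> m" "norm (N v *v w) \<le> norm v * norm w * m" for v w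
    using N.nonneg_bounded by blast
  obtain k where k: "norm (N (\<pi> v) *v \<pi> v - N (\<pi> w) *v \<pi> w) \<le> k * norm (v - w)" for v w
    using bilinear_square_truncation_lipschitz[OF N.bounded_bilinear_axioms \<open>0 \<le> \<rho>\<close>]
    unfolding \<pi>_def by metis
  have lin: "norm (lin t v) \<le> (a + 2 * X * m + g) * norm v" if "0 \<le> t" for t v
  proof -
    have "norm (N v *v x t) \<le> norm v * X * m" "norm (N (x t) *v v) \<le> X * norm v * m"
      using m(1) X[OF that] by (auto intro!: order_trans[OF m(2)] mult_right_mono mult_left_mono)
    then have "norm (lin t v) \<le> norm v * a + norm v * X * m + X * norm v * m + norm v * g"
      unfolding lin_def shifted_matrix_works[OF \<open>linear N\<close>]
      by (intro norm_triangle_mono a g)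
    then show ?thesis
      by (simp add: algebra_simps)
  qed
  have "\<exists>e. e 0 = e\<^sub>0 \<and> (\<forall>t\<ge>0. (e has_vector_derivative f t (e t)) (at t within {0..}))"
  proof (rule lipschitz_ode_global_solution)
    have \<pi>: "continuous_on UNIV \<pi>"
      unfolding \<pi>_def using \<open>0 \<le> \<rho>\<close> by (intro continuous_on_closest_point) auto
    show "continuous_on ({0..} \<times> UNIV) (\<lambda>(t, v). f t v)"
      unfolding case_prod_beta f_def lin_def shifted_matrix_works[OF \<open>linear N\<close>]
      by (intro continuous_intros N.continuous_on continuous_on_compose2[OF x(1)]
          continuous_on_compose2[OF \<pi>]
          bounded_linear.continuous_on[OF matrix_vector_mul_bounded_linear]) auto
    fix t :: real assume t: "0 \<le> t"
    show "norm (f t v - f t w) \<le> (a + 2 * X * m + g + k) * norm (v - w)" for v w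
    proof -
      have "f t v - f t w = lin t (v - w) - (N (\<pi> v) *v \<pi> v - N (\<pi> w) *v \<pi> w)"
        by (simp add: f_def lin_def matrix_vector_mult_diff_distrib algebra_simps)
      also have "norm \<dots> \<le> (a + 2 * X * m + g) * norm (v - w) + k * norm (v - w)"
        by (rule order_trans[OF norm_triangle_ineq4 add_mono[OF lin[OF t] k]])
      finally show ?thesis
        by (simp add: algebra_simps)
    qed
    show "norm (f t 0) \<le> norm (N (\<pi> 0) *v \<pi> 0)"
      by (simp add: f_def lin_def)
  qed
  then show thesis
    using that by (auto simp: f_def lin_def ode_solution_def)
qed

section \<open>Convergence of the observer\<close>

theorem theorem2p15:
  fixes A Q P :: "real ^ 'n ^ 'n"
    and C :: "real ^ 'n ^ 'p"
    and R L :: "real ^ 'p ^ 'n"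
    and N :: "real ^ 'n \<Rightarrow> real ^ 'n ^ 'n"
    and d x\<^sub>0 xhat\<^sub>0 :: "real ^ 'n"
    and r :: real
    and x :: "real \<Rightarrow> real ^ 'n"
    and Y :: "(real ^ 'n) set"
  assumes "linear N"
    and "\<And>v. v \<bullet> (N v *v v) = 0"
    and "\<And>v. Q *v v = 0 \<Longrightarrow> N v *v v = 0"
    and "sdp_ball A N Q d r"
    and "invariant_set (system_rhs A N) (cball d r)"
    and "ode_solution (\<lambda>_. system_rhs A N) x"
    and "x 0 = x\<^sub>0" and "x\<^sub>0 \<in> cball d r"
    and "cball d r \<subseteq> Y"
    and "P \<in> sym_matrices_N N" and "pos_def P"
    and "\<And>y. y \<in> Y \<Longrightarrow>
           neg_def (P ** shifted_matrix A N y + transpose (shifted_matrix A N y) ** P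
                    + R ** C + transpose C ** transpose R)"
    and "L = matrix_inv P ** R"
  shows "(\<exists>xhat. ode_solution (observer_rhs A N C L x) xhat \<and> xhat 0 = xhat\<^sub>0) \<and>
         (\<forall>xhat. ode_solution (observer_rhs A N C L x) xhat \<and> xhat 0 = xhat\<^sub>0 \<longrightarrow>
            ((\<lambda>t. x t - xhat t) \<longlongrightarrow> 0) at_top)"
proof -
  have x': "(x has_vector_derivative system_rhs A N (x t)) (at t within {0..})" if "0 \<le> t" for t
    using \<open>ode_solution (\<lambda>_. system_rhs A N) x\<close> that by (simp add: ode_solution_def)
  have "x t \<in> cball d r" if "0 \<le> t" for t
    using \<open>invariant_set (system_rhs A N) (cball d r)\<close> \<open>ode_solution (\<lambda>_. system_rhs A N) x\<close>
      \<open>x 0 = x\<^sub>0\<close> \<open>x\<^sub>0 \<in> cball d r\<close> that by (auto simp: invariant_set_def)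
  then have x_cball: "x ` {0..} \<subseteq> cball d r"
    by auto
  have PL: "P ** L = R"
    using someI_ex[OF pos_def_imp_invertible[OF \<open>pos_def P\<close>, unfolded invertible_def]]
    by (simp add: \<open>L = matrix_inv P ** R\<close> matrix_mul_assoc flip: matrix_inv_def)
  have neg: "neg_def (P ** shifted_matrix A N y + transpose (shifted_matrix A N y) ** P
      + R ** C + transpose C ** transpose R)" if "y \<in> cball d r" for y
    using assms(9,12) that by blast
  obtain q \<kappa> where "0 < q" "0 < \<kappa>"
    and decay: "\<forall>e \<gamma>. ode_solution (\<lambda>t. error_rhs A N (L ** C) (\<gamma> t) (x t)) e
      \<longrightarrow> (\<forall>t\<ge>0. q * (norm (e t))\<^sup>2 \<le> (e 0 \<bullet> (P *v e 0)) * exp (- \<kappa> * t))"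
    using error_exponential_decay[OF \<open>linear N\<close> \<open>P \<in> sym_matrices_N N\<close> \<open>pos_def P\<close> PL
        compact_cball x_cball neg] by blast
  define V where "V = (x\<^sub>0 - xhat\<^sub>0) \<bullet> (P *v (x\<^sub>0 - xhat\<^sub>0))"
  have "0 \<le> V"
    using \<open>pos_def P\<close> by (cases "x\<^sub>0 - xhat\<^sub>0 = 0") (auto simp: V_def pos_def_iff less_imp_le)
  have "\<exists>xhat. ode_solution (observer_rhs A N C L x) xhat \<and> xhat 0 = xhat\<^sub>0"
  proof -
    \<comment> \<open>The energy starts at \<open>V\<close>, does not increase and is at least \<open>q\<close> times the squared norm,
      so the norm stays below this radius.\<close>
    define \<rho> where "\<rho> = sqrt (V / q)"
    have "0 \<le> \<rho>"
      using \<open>0 \<le> V\<close> \<open>0 < q\<close> by (simp add: \<rho>_def)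
    let ?\<pi> = "closest_point (cball (0 :: real ^ 'n) \<rho>)"
    have "continuous_on {0..} x"
      by (rule continuous_on_vector_derivative, rule x') simp
    moreover have "bounded (x ` {0..})"
      using x_cball by (rule bounded_subset[OF bounded_cball])
    ultimately obtain e where e0: "e 0 = x\<^sub>0 - xhat\<^sub>0" and "ode_solution
        (\<lambda>t v. shifted_matrix A N (x t) *v v + (L ** C) *v v - N (?\<pi> v) *v ?\<pi> v) e"
      by (rule truncated_error_solution[OF \<open>linear N\<close> \<open>0 \<le> \<rho>\<close>])
    then have e: "(e has_vector_derivative shifted_matrix A N (x t) *v e t + (L ** C) *v e t
           - N (?\<pi> (e t)) *v ?\<pi> (e t)) (at t within {0..})" if "0 \<le> t" for t
      using that by (simp add: ode_solution_def)
    obtain c where c: "?\<pi> v = c v *\<^sub>R v" for v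
      using closest_point_cball_0[OF \<open>0 \<le> \<rho>\<close>] by metis
    have truncated: "ode_solution (\<lambda>t. error_rhs A N (L ** C) ((c (e t))\<^sup>2) (x t)) e"
      using e by (simp add: ode_solution_def error_rhs_def c linear_scale[OF \<open>linear N\<close>]
          matrix_vector_mult_scaleR power2_eq_square flip: scaleR_matrix_vector_assoc)
    have "norm (e t) \<le> \<rho>" if "0 \<le> t" for t
    proof -
      have "q * (norm (e t))\<^sup>2 \<le> V * exp (- \<kappa> * t)"
        using decay[rule_format, OF truncated that] by (simp add: e0 V_def)
      also have "\<dots> \<le> V"
        using \<open>0 \<le> V\<close> \<open>0 < \<kappa>\<close> that by (intro mult_left_le) auto
      finally show ?thesis
        unfolding \<rho>_def using \<open>0 < q\<close> by (intro real_le_rsqrt) (simp add: field_simps)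
    qed
    \<comment> \<open>Within the ball the projection is the identity, so the truncation never takes effect.\<close>
    then have "(e has_vector_derivative error_rhs A N (L ** C) 1 (x t) (e t)) (at t within {0..})"
      if "0 \<le> t" for t
      using e[OF that] that by (simp add: error_rhs_def closest_point_self)
    then have "((\<lambda>t. x t - e t) has_vector_derivative
        system_rhs A N (x t) - error_rhs A N (L ** C) 1 (x t) (e t)) (at t within {0..})"
      if "0 \<le> t" for t
      using that by (intro has_vector_derivative_diff x')
    moreover have "system_rhs A N (x t) - error_rhs A N (L ** C) 1 (x t) (e t)
        = observer_rhs A N C L x t (x t - e t)" for t
      using system_minus_observer_rhs[OF \<open>linear N\<close>, of A x t C L "x t - e t"]
      by (simp add: algebra_simps)
    ultimately have "ode_solution (observer_rhs A N C L x) (\<lambda>t. x t - e t)"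
      by (simp add: ode_solution_def)
    then show ?thesis
      using e0 \<open>x 0 = x\<^sub>0\<close> by (intro exI[of _ "\<lambda>t. x t - e t"]) simp
  qed
  moreover have "((\<lambda>t. x t - xhat t) \<longlongrightarrow> 0) at_top"
    if xhat: "ode_solution (observer_rhs A N C L x) xhat" "xhat 0 = xhat\<^sub>0" for xhat
  proof -
    have error: "ode_solution (\<lambda>t. error_rhs A N (L ** C) 1 (x t)) (\<lambda>t. x t - xhat t)"
      unfolding ode_solution_def system_minus_observer_rhs[OF \<open>linear N\<close>, symmetric]
      using xhat(1) by (auto simp: ode_solution_def intro!: has_vector_derivative_diff x')
    have bound: "(norm (x t - xhat t))\<^sup>2 \<le> V / q * exp (- \<kappa> * t)" if "0 \<le> t" for t
      using decay[rule_format, OF error that] \<open>0 < q\<close>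
      by (simp add: V_def xhat \<open>x 0 = x\<^sub>0\<close> field_simps)
    have "((\<lambda>t. V / q * exp (- \<kappa> * t)) \<longlongrightarrow> 0) at_top"
      using \<open>0 < \<kappa>\<close>
      by (intro tendsto_mult_right_zero filterlim_compose[OF exp_at_bot]
          filterlim_tendsto_neg_mult_at_bot[OF tendsto_const _ filterlim_ident]) simp
    moreover have "\<forall>\<^sub>F t in at_top. norm ((norm (x t - xhat t))\<^sup>2) \<le> V / q * exp (- \<kappa> * t)"
    proof (rule eventually_at_top_linorderI[of 0])
      show "norm ((norm (x t - xhat t))\<^sup>2) \<le> V / q * exp (- \<kappa> * t)" if "0 \<le> t" for t
        using bound[OF that] by simp
    qed
    ultimately have "((\<lambda>t. (norm (x t - xhat t))\<^sup>2) \<longlongrightarrow> 0) at_top"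
      by (rule Lim_null_comparison[rotated])
    then show ?thesis
      by (simp add: tendsto_norm_zero_iff)
  qed
  ultimately show ?thesis
    by blast
qed

end
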